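(* For every integer $k$, there exist a finite field $\mathbb{F}$ and a family $\{\mathcal{I}_j\}$ for which $\mathsf{S}_{\mathrm{L}}(\{\mathcal{I}_j\})>\mathsf{S}(\{\mathcal{I}_j\})+k$.
   Context: Network model: there are $n$ clients $c_1,\dots,c_n$, a positive integer $m$, and sets $\mathcal{I}_1,\dots,\mathcal{I}_n\subseteq[m]$ with $\bigcup_j\mathcal{I}_j=[m]$; write $\{\mathcal{I}_j\}$ for the family. The messages $X_1,\dots,X_m$ are mutually independent, each uniformly distributed on a finite field $\mathbb{F}$ with $|\mathbb{F}|>n$; client $c_j$ initially holds $\{X_i:i\in\mathcal{I}_j\}$; $\underline{X}=(X_1,\dots,X_m)^T$. All clients know all the sets $\mathcal{I}_j$. A protocol with $t$ rounds specifies, for each round $k=1,\dots,t$, a client $c_{i_k}$ that broadcasts (error-free, to everyone) one element of $\mathbb{F}$ which is a deterministic function of the messages held by $c_{i_k}$, of $k$, and of all previously broadcast symbols. $\mathbf{T}(\underline{X})\in\mathbb{F}^t$ is the vector of broadcast symbols; $t$ is the number of transmissions. A protocol is linear (over $\mathbb{F}$) if every broadcast symbol is an $\mathbb{F}$-linear combination of the messages held by the transmitting client, so $\mathbf{T}(\underline{X})=A\underline{X}$ for some $A\in\mathbb{F}^{t\times m}$. A protocol generates a secret key (SK) if there exist functions $\mathsf{k}_1,\dots,\mathsf{k}_n$ such that, with $K=\mathsf{k}_1(\{X_i:i\in\mathcal{I}_1\},\mathbf{T}(\underline{X}))$: (i) $\mathsf{k}_j(\{X_i:i\in\mathcal{I}_j\},\mathbf{T}(\underline{X}))=K$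 with probability 1 for all $j$; (ii) $K$ is uniform on $\mathbb{F}$; (iii) $I(K;\mathbf{T}(\underline{X}))=0$. $\mathsf{S}(\{\mathcal{I}_j\})$ (resp. $\mathsf{S}_{\mathrm{L}}(\{\mathcal{I}_j\})$) is the minimum number of transmissions over all protocols (resp. all linear protocols) that generate a SK, and $\infty$ if there is none. *)

theory Defs
  imports "HOL-Algebra.Ring" "HOL-Algebra.FiniteProduct" "HOL-Library.Extended_Real" "HOL-Library.FuncSet"
begin

text \<open>Messages are indexed by 1..m, clients by 1..n.  A realisation of
  the message vector is an element of the extensional function space
  over 1..m with values in the field carrier; the uniform distribution
  on it is handled by counting.\<close>

definition msgs :: "('a, 'b) ring_scheme \<Rightarrow> nat \<Rightarrow> (nat \<Rightarrow> 'a) set" where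
  "msgs R m = PiE {1..m} (\<lambda>_. carrier R)"

text \<open>Transcript after k rounds: in round k the speaker sp k broadcasts
  f k (its own messages) (previous broadcasts).\<close>

fun transcript :: "(nat \<Rightarrow> nat set) \<Rightarrow> (nat \<Rightarrow> nat)
    \<Rightarrow> (nat \<Rightarrow> (nat \<Rightarrow> 'a) \<Rightarrow> 'a list \<Rightarrow> 'a) \<Rightarrow> nat \<Rightarrow> (nat \<Rightarrow> 'a) \<Rightarrow> 'a list" where
  "transcript I sp f 0 x = []"
| "transcript I sp f (Suc k) x =
     transcript I sp f k x @ [f (Suc k) (restrict x (I (sp (Suc k)))) (transcript I sp f k x)]"

definition is_protocol ::
  "('a, 'b) ring_scheme \<Rightarrow> nat \<Rightarrow> nat \<Rightarrow> (nat \<Rightarrow> nat set) \<Rightarrow> nat \<Rightarrow> (nat \<Rightarrow> nat)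
    \<Rightarrow> (nat \<Rightarrow> (nat \<Rightarrow> 'a) \<Rightarrow> 'a list \<Rightarrow> 'a) \<Rightarrow> bool" where
  "is_protocol R n m I t sp f \<longleftrightarrow>
     (\<forall>k\<in>{1..t}. sp k \<in> {1..n}) \<and>
     (\<forall>x\<in>msgs R m. set (transcript I sp f t x) \<subseteq> carrier R)"

definition is_linear ::
  "('a, 'b) ring_scheme \<Rightarrow> nat \<Rightarrow> (nat \<Rightarrow> nat set) \<Rightarrow> nat \<Rightarrow> (nat \<Rightarrow> nat)
    \<Rightarrow> (nat \<Rightarrow> (nat \<Rightarrow> 'a) \<Rightarrow> 'a list \<Rightarrow> 'a) \<Rightarrow> bool" where
  "is_linear R m I t sp f \<longleftrightarrow>
     (\<forall>k\<in>{1..t}. \<exists>c. (\<forall>i\<in>I (sp k). c i \<in> carrier R) \<and>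
        (\<forall>x\<in>msgs R m. transcript I sp f t x ! (k - 1) =
            finsum R (\<lambda>i. c i \<otimes>\<^bsub>R\<^esub> x i) (I (sp k))))"

text \<open>Secret-key generation: (i) agreement with probability 1,
  (ii) K uniform on F, (iii) I(K;T) = 0, i.e. K and T independent,
  all under the uniform distribution on msgs R m (expressed by counting).\<close>

definition generates_SK ::
  "('a, 'b) ring_scheme \<Rightarrow> nat \<Rightarrow> nat \<Rightarrow> (nat \<Rightarrow> nat set) \<Rightarrow> nat \<Rightarrow> (nat \<Rightarrow> nat)
    \<Rightarrow> (nat \<Rightarrow> (nat \<Rightarrow> 'a) \<Rightarrow> 'a list \<Rightarrow> 'a) \<Rightarrow> bool" where
  "generates_SK R n m I t sp f \<longleftrightarrow>
     (\<exists>kf :: nat \<Rightarrow> (nat \<Rightarrow> 'a) \<Rightarrow> 'a list \<Rightarrow> 'a.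
        let M = msgs R m;
            T = transcript I sp f t;
            K = (\<lambda>x. kf 1 (restrict x (I 1)) (T x))
        in (\<forall>j\<in>{1..n}. \<forall>x\<in>M. kf j (restrict x (I j)) (T x) = K x) \<and>
           (\<forall>a\<in>carrier R. card {x\<in>M. K x = a} * card (carrier R) = card M) \<and>
           (\<forall>a \<tau>. card {x\<in>M. K x = a \<and> T x = \<tau>} * card M
                   = card {x\<in>M. K x = a} * card {x\<in>M. T x = \<tau>}))"

text \<open>Minimum number of transmissions (infinity if no protocol exists).\<close>

definition SK_min :: "('a, 'b) ring_scheme \<Rightarrow> nat \<Rightarrow> nat \<Rightarrow> (nat \<Rightarrow> nat set) \<Rightarrow> enat" where
  "SK_min R n m I = Inf (enat ` {t. \<exists>sp f. is_protocol R n m I t sp f \<and> generates_SK R n m I t sp f})"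

definition SK_min_lin :: "('a, 'b) ring_scheme \<Rightarrow> nat \<Rightarrow> nat \<Rightarrow> (nat \<Rightarrow> nat set) \<Rightarrow> enat" where
  "SK_min_lin R n m I = Inf (enat ` {t. \<exists>sp f. is_protocol R n m I t sp f \<and> is_linear R m I t sp f
                                              \<and> generates_SK R n m I t sp f})"

end

theory Submission
  imports Defs "HOL-Algebra.QuotRing" "HOL-Number_Theory.Cong" "HOL-Computational_Algebra.Primes"
begin

text \<open>
  There are \<open>m = 2 h\<close> messages, one client knowing all of them, and for every pair of messages a client
  knowing just that pair.

  For linear protocols the key must be constant on cosets of the kernel of the transmitted map,
  as soon as this kernel is spanned by vectors vanishing in two coordinates, because the client
  holding these coordinates cannot notice such a translation. With \<open>t\<close> rounds, the kernel is
  spanned by vectors of support at most \<open>t + 1\<close>, so \<open>t \<ge> m - 2\<close>.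

  If the field has \<open>p\<^sup>2\<close> elements, a symbol consists of two halves in \<open>\<int>/p\<close>. The all-knowing
  client broadcasts the \<open>m - 2\<close> syndromes of the first halves with respect to the Reed-Solomon code
  of dimension 2, packed into \<open>h - 1\<close> symbols. Two first halves then determine all of them, and
  the first halves of messages 1 and 2 form a key independent of the syndromes.
\<close>

subsection \<open>Fields of order \<open>p\<^sup>2\<close>\<close>

text \<open>The ring \<open>(Z/p)[X]/(X^2 - g)\<close>: the pair \<open>(a, b)\<close> stands for
  \<open>a + b * sqrt g\<close>, with both entries represented in \<open>{0..<p}\<close>.\<close>

definition quad_ring :: "int \<Rightarrow> int \<Rightarrow> (int \<times> int) ring" where
  "quad_ring p g = \<lparr>carrier = {0..<p} \<times> {0..<p},
     monoid.mult = (\<lambda>(a, b) (c, d). ((a * c + g * (b * d)) mod p, (a * d + b * c) mod p)),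
     monoid.one = (1, 0), ring.zero = (0, 0),
     ring.add = (\<lambda>(a, b) (c, d). ((a + c) mod p, (b + d) mod p))\<rparr>"

text \<open>Squaring maps the residues to themselves but identifies 1 and \<open>p - 1\<close>, so
  on this finite set it is not onto.\<close>

lemma exists_nonresidue:
  fixes p :: int
  assumes "p > 2"
  shows "\<exists>g. \<forall>x. \<not> [x * x = g] (mod p)"
proof -
  let ?f = "\<lambda>x::int. x * x mod p"
  have "(p - 1) * (p - 1) = 1 + p * (p - 2)" by (simp add: algebra_simps)
  then have "?f (p - 1) = ?f 1" by simp
  moreover have "p - 1 \<noteq> 1" using assms by simp
  ultimately have "\<not> inj_on ?f {0..<p}"
    using assms by (auto dest!: inj_onD[where x = "p - 1" and y = 1])
  then have "?f ` {0..<p} \<noteq> {0..<p}"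
    using eq_card_imp_inj_on[of "{0..<p}" ?f] by auto
  moreover have "?f ` {0..<p} \<subseteq> {0..<p}" using assms by auto
  ultimately obtain g where g: "g \<in> {0..<p}" "g \<notin> ?f ` {0..<p}" by blast
  have "\<not> [x * x = g] (mod p)" for x
  proof
    assume "[x * x = g] (mod p)"
    then have "?f (x mod p) = g" using g by (simp add: cong_def mod_mult_eq)
    moreover have "x mod p \<in> {0..<p}" using assms by simp
    ultimately show False using g by blast
  qed
  then show ?thesis by blast
qed

text \<open>The expression is the norm of \<open>a + b * sqrt g\<close>. If \<open>p\<close> divided
  it but not \<open>b\<close>, then \<open>a\<close> times the inverse of \<open>b\<close> would be
  a square root of \<open>g\<close>; if \<open>p\<close> divided \<open>b\<close> too, it would
  divide \<open>a * a\<close> and hence \<open>a\<close>.\<close>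

lemma norm_nonzero:
  fixes p a b g :: int
  assumes "prime p" "\<And>x. \<not> [x * x = g] (mod p)" "\<not> (p dvd a \<and> p dvd b)"
  shows "\<not> p dvd a * a - g * (b * b)"
proof
  assume dvd: "p dvd a * a - g * (b * b)"
  show False
  proof (cases "p dvd b")
    case True
    then have "p dvd a * a"
      using dvd by (metis dvd_diff_right_iff dvd_mult dvd_mult2 dvd_diff_left_iff)
    then show False using assms True by (simp add: prime_dvd_mult_iff)
  next
    case False
    then have "coprime b p"
      using assms(1) by (metis coprime_commute prime_imp_coprime)
    then obtain c where c: "[b * c = 1] (mod p)" using cong_solve_coprime_int by blast
    have "[a * a = g * (b * b)] (mod p)" using dvd by (simp add: cong_iff_dvd_diff)
    then have "[(a * a) * (c * c) = (g * (b * b)) * (c * c)] (mod p)"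
      by (rule cong_mult) simp
    moreover have "[g * ((b * c) * (b * c)) = g * (1 * 1)] (mod p)"
      using c by (intro cong_mult) auto
    ultimately have "[(a * c) * (a * c) = g] (mod p)"
      by (metis (no_types, lifting) cong_trans mult.assoc mult.commute mult.left_commute mult_1_right)
    then show False using assms(2) by blast
  qed
qed

text \<open>Dropping the inner reductions turns associativity and distributivity into polynomial
  identities over the integers.\<close>

lemma quad_mult_mod:
  fixes a b c d p g :: int
  shows "((a mod p) * c + g * ((b mod p) * d)) mod p = (a * c + g * (b * d)) mod p"
    and "(a * (c mod p) + g * (b * (d mod p))) mod p = (a * c + g * (b * d)) mod p"
    and "((a mod p) * d + (b mod p) * c) mod p = (a * d + b * c) mod p"
    and "(a * (d mod p) + b * (c mod p)) mod p = (a * d + b * c) mod p"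
  by (fold cong_def) (intro cong_add cong_mult cong_refl; simp)+

lemma cring_quad_ring:
  assumes "p > 1"
  shows "cring (quad_ring p g)"
proof (rule cringI)
  show "abelian_group (quad_ring p g)"
  proof (rule abelian_groupI)
    fix x assume "x \<in> carrier (quad_ring p g)"
    then show "\<exists>y\<in>carrier (quad_ring p g). y \<oplus>\<^bsub>quad_ring p g\<^esub> x = \<zero>\<^bsub>quad_ring p g\<^esub>"
      using assms by (intro bexI[of _ "((- fst x) mod p, (- snd x) mod p)"])
        (auto simp: quad_ring_def mod_simps)
  qed (use assms in \<open>auto simp: quad_ring_def mod_simps algebra_simps\<close>)
  show "comm_monoid (quad_ring p g)"
  proof (rule comm_monoidI)
    fix x y z
    assume "x \<in> carrier (quad_ring p g)" "y \<in> carrier (quad_ring p g)" "z \<in> carrier (quad_ring p g)"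
    show "x \<otimes>\<^bsub>quad_ring p g\<^esub> y \<otimes>\<^bsub>quad_ring p g\<^esub> z = x \<otimes>\<^bsub>quad_ring p g\<^esub> (y \<otimes>\<^bsub>quad_ring p g\<^esub> z)"
      by (cases x; cases y; cases z) (simp add: quad_ring_def quad_mult_mod, simp add: algebra_simps)
  qed (use assms in \<open>auto simp: quad_ring_def mod_simps algebra_simps\<close>)
  fix x y z
  assume "x \<in> carrier (quad_ring p g)" "y \<in> carrier (quad_ring p g)" "z \<in> carrier (quad_ring p g)"
  show "(x \<oplus>\<^bsub>quad_ring p g\<^esub> y) \<otimes>\<^bsub>quad_ring p g\<^esub> z =
      x \<otimes>\<^bsub>quad_ring p g\<^esub> z \<oplus>\<^bsub>quad_ring p g\<^esub> y \<otimes>\<^bsub>quad_ring p g\<^esub> z"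
    by (cases x; cases y; cases z)
      (simp add: quad_ring_def quad_mult_mod mod_add_eq, simp add: algebra_simps)
qed

lemma field_quad_ring:
  assumes p: "prime p" and g: "\<And>x. \<not> [x * x = g] (mod p)"
  shows "field (quad_ring p g)"
proof -
  have p1: "p > 1" using p by (simp add: prime_gt_1_int)
  interpret cring "quad_ring p g" by (rule cring_quad_ring[OF p1])
  have nz: "\<one>\<^bsub>quad_ring p g\<^esub> \<noteq> \<zero>\<^bsub>quad_ring p g\<^esub>" by (simp add: quad_ring_def)
  show ?thesis
  proof (intro cring_fieldI equalityI subsetI)
    fix x assume x: "x \<in> Units (quad_ring p g)"
    then obtain y where y: "y \<in> carrier (quad_ring p g)" "x \<otimes>\<^bsub>quad_ring p g\<^esub> y = \<one>\<^bsub>quad_ring p g\<^esub>"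
      using Units_r_inv_ex by blast
    then have "x \<noteq> \<zero>\<^bsub>quad_ring p g\<^esub>" using nz l_null by auto
    then show "x \<in> carrier (quad_ring p g) - {\<zero>\<^bsub>quad_ring p g\<^esub>}" using x Units_closed by blast
  next
    fix x assume x: "x \<in> carrier (quad_ring p g) - {\<zero>\<^bsub>quad_ring p g\<^esub>}"
    obtain a b where ab: "x = (a, b)" by fastforce
    have "\<not> (p dvd a \<and> p dvd b)"
    proof
      assume "p dvd a \<and> p dvd b"
      moreover have "0 \<le> a" "a < p" "0 \<le> b" "b < p" "a \<noteq> 0 \<or> b \<noteq> 0"
        using x by (auto simp: quad_ring_def ab)
      ultimately show False using zdvd_not_zless[of a p] zdvd_not_zless[of b p] by linarith
    qed
    then have "\<not> p dvd a * a - g * (b * b)" using norm_nonzero[OF p] g by blast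
    then have "coprime (a * a - g * (b * b)) p"
      using p by (meson coprime_commute prime_imp_coprime)
    then obtain c where c: "[(a * a - g * (b * b)) * c = 1] (mod p)"
      using cong_solve_coprime_int by blast
    \<comment> \<open>The inverse is the conjugate \<open>a - b * sqrt g\<close> times the inverse
      \<open>c\<close> of the norm.\<close>
    let ?y = "(a * c mod p, (- b * c) mod p)"
    have "a * (a * c) + g * (b * (- b * c)) = (a * a - g * (b * b)) * c"
      by (simp add: algebra_simps)
    then have "x \<otimes>\<^bsub>quad_ring p g\<^esub> ?y = \<one>\<^bsub>quad_ring p g\<^esub>"
      using c p1 unfolding quad_ring_def ab cong_def
      by (simp only: quad_mult_mod prod.case ring.simps monoid.simps) simp
    moreover have "?y \<in> carrier (quad_ring p g)" using p1 by (simp add: quad_ring_def)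
    ultimately show "x \<in> Units (quad_ring p g)"
      using x m_comm[of x ?y] by (auto simp: Units_def intro!: bexI[of _ ?y])
  qed
qed

section \<open>Fields of prime square order on the natural numbers\<close>

text \<open>Transport of structure: the operations of \<open>R\<close> are carried over to the image
  by \<open>h\<close> and its inverse. This moves the field of pairs to the type
  \<open>nat\<close>.\<close>

lemma exists_field_on:
  fixes R :: "'a ring" and h :: "'a \<Rightarrow> 'b"
  assumes "field R" and inj: "inj_on h (carrier R)"
  shows "\<exists>S :: 'b ring. field S \<and> carrier S = h ` carrier R"
proof -
  interpret field R by fact
  let ?g = "the_inv_into (carrier R) h"
  let ?S = "\<lparr>carrier = h ` carrier R, monoid.mult = (\<lambda>x y. h (?g x \<otimes>\<^bsub>R\<^esub> ?g y)), monoid.one = h \<one>\<^bsub>R\<^esub>,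
     ring.zero = h \<zero>\<^bsub>R\<^esub>, ring.add = (\<lambda>x y. h (?g x \<oplus>\<^bsub>R\<^esub> ?g y))\<rparr>"
  have "h \<in> ring_iso R ?S"
    using inj by (intro ring_iso_memI) (auto simp: the_inv_into_f_f bij_betw_def)
  from ring_iso_imp_img_field[OF this] show ?thesis by (intro exI[of _ ?S]) simp
qed

lemma exists_field_prime_square:
  assumes "prime p" "p > 2"
  shows "\<exists>R :: nat ring. field R \<and> finite (carrier R) \<and> card (carrier R) = p * p"
proof -
  obtain g :: int where g: "\<And>x. \<not> [x * x = g] (mod int p)"
    using exists_nonresidue[of "int p"] assms by auto
  let ?Q = "quad_ring (int p) g"
  have Q: "carrier ?Q = {0..<int p} \<times> {0..<int p}" by (simp add: quad_ring_def)
  then obtain h :: "int \<times> int \<Rightarrow> nat" where h: "inj_on h (carrier ?Q)"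
    using finite_imp_inj_to_nat_seg[of "carrier ?Q"] by auto
  obtain S :: "nat ring" where "field S" "carrier S = h ` carrier ?Q"
    using exists_field_on[OF field_quad_ring h] g assms by auto
  then show ?thesis using Q h by (intro exI[of _ S]) (simp add: card_image card_cartesian_product)
qed

subsection \<open>The lower bound for linear protocols\<close>

text \<open>One operation serves for sums, differences (\<open>r = \<ominus> \<one>\<close>) and
  multiples (\<open>x\<close> the zero vector). Restricting to \<open>{1..m}\<close> keeps the
  result in the extensional space \<open>msgs R m\<close>.\<close>

definition axpy :: "('a, 'b) ring_scheme \<Rightarrow> nat \<Rightarrow> (nat \<Rightarrow> 'a) \<Rightarrow> 'a \<Rightarrow> (nat \<Rightarrow> 'a) \<Rightarrow> nat \<Rightarrow> 'a" where
  "axpy R m x r y = (\<lambda>i\<in>{1..m}. x i \<oplus>\<^bsub>R\<^esub> r \<otimes>\<^bsub>R\<^esub> y i)"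

lemma msgsD: "x \<in> msgs R m \<Longrightarrow> i \<in> {1..m} \<Longrightarrow> x i \<in> carrier R"
  by (auto simp: msgs_def)

lemma msgs_eqI:
  "x \<in> msgs R m \<Longrightarrow> y \<in> msgs R m \<Longrightarrow> (\<And>i. i \<in> {1..m} \<Longrightarrow> x i = y i) \<Longrightarrow> x = y"
  unfolding msgs_def by (rule PiE_ext)

lemma axpy_apply: "i \<in> {1..m} \<Longrightarrow> axpy R m x r y i = x i \<oplus>\<^bsub>R\<^esub> r \<otimes>\<^bsub>R\<^esub> y i"
  by (simp add: axpy_def)

lemma (in ring) axpy_msgs:
  "x \<in> msgs R m \<Longrightarrow> y \<in> msgs R m \<Longrightarrow> r \<in> carrier R \<Longrightarrow> axpy R m x r y \<in> msgs R m"
  by (auto simp: axpy_def msgs_def)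

lemma (in cring) finsum_axpy:
  assumes "J \<subseteq> {1..m}" "\<And>i. i \<in> J \<Longrightarrow> c i \<in> carrier R"
    "x \<in> msgs R m" "y \<in> msgs R m" "r \<in> carrier R"
  shows "finsum R (\<lambda>i. c i \<otimes> axpy R m x r y i) J
    = finsum R (\<lambda>i. c i \<otimes> x i) J \<oplus> r \<otimes> finsum R (\<lambda>i. c i \<otimes> y i) J"
proof -
  have fin: "finite J" using assms(1) finite_subset by blast
  have car: "x i \<in> carrier R" "y i \<in> carrier R" "c i \<in> carrier R" if "i \<in> J" for i
    using that assms msgsD by blast+
  have "finsum R (\<lambda>i. c i \<otimes> axpy R m x r y i) J
      = finsum R (\<lambda>i. c i \<otimes> x i \<oplus> r \<otimes> (c i \<otimes> y i)) J"
  proof (rule finsum_cong')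
    fix i assume i: "i \<in> J"
    then have "i \<in> {1..m}" using assms(1) by blast
    then show "c i \<otimes> axpy R m x r y i = c i \<otimes> x i \<oplus> r \<otimes> (c i \<otimes> y i)"
      using car[OF i] assms(5) by (simp add: axpy_apply r_distr m_lcomm)
  qed (use car assms(5) in auto)
  also have "\<dots> = finsum R (\<lambda>i. c i \<otimes> x i) J \<oplus> finsum R (\<lambda>i. r \<otimes> (c i \<otimes> y i)) J"
    using car assms(5) by (intro finsum_addf) auto
  also have "finsum R (\<lambda>i. r \<otimes> (c i \<otimes> y i)) J = r \<otimes> finsum R (\<lambda>i. c i \<otimes> y i) J"
    using car fin assms(5) by (intro finsum_rdistr[symmetric]) auto
  finally show ?thesis .
qed

text \<open>Induction on the size of the support. A vector with large support is a difference of two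
  vectors of \<open>V\<close> with smaller support, obtained by cancelling one coordinate with a
  short vector from \<open>ex\<close>; translation by either of these preserves
  \<open>K\<close>.\<close>

lemma (in field) invariant_if_invariant_small_support:
  assumes V: "V \<subseteq> msgs R m" "(\<lambda>i\<in>{1..m}. \<zero>) \<in> V"
      "\<And>x y r. x \<in> V \<Longrightarrow> y \<in> V \<Longrightarrow> r \<in> carrier R \<Longrightarrow> axpy R m x r y \<in> V"
    and ex: "\<And>S. S \<subseteq> {1..m} \<Longrightarrow> card S = Suc t \<Longrightarrow>
      \<exists>w\<in>V. (\<exists>i\<in>{1..m}. w i \<noteq> \<zero>) \<and> (\<forall>i\<in>{1..m} - S. w i = \<zero>)"
    and small: "\<And>x d. x \<in> msgs R m \<Longrightarrow> d \<in> V \<Longrightarrow> card {i\<in>{1..m}. d i \<noteq> \<zero>} \<le> Suc t \<Longrightarrow>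
      K (axpy R m x \<one> d) = K x"
    and "d \<in> V" "x \<in> msgs R m"
  shows "K (axpy R m x \<one> d) = K x"
  using \<open>d \<in> V\<close> \<open>x \<in> msgs R m\<close>
proof (induction "card {i\<in>{1..m}. d i \<noteq> \<zero>}" arbitrary: d x rule: less_induct)
  case less
  define D where "D = {i\<in>{1..m}. d i \<noteq> \<zero>}"
  have D: "D \<subseteq> {1..m}" "finite D" by (auto simp: D_def)
  show ?case
  proof (cases "card D \<le> Suc t")
    case True
    then show ?thesis using small less.prems by (simp add: D_def)
  next
    case False
    \<comment> \<open>Leaving out \<open>s\<close> makes the support of the short vector
      \<open>w\<close>, and of its multiples, a proper subset of \<open>D\<close>.\<close>
    then obtain s where s: "s \<in> D" by fastforce
    have "Suc t \<le> card (D - {s})" using False s D by simp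
    then obtain S where S: "S \<subseteq> D - {s}" "card S = Suc t"
      using obtain_subset_with_card_n by metis
    then obtain w j where w: "w \<in> V" "\<forall>i\<in>{1..m} - S. w i = \<zero>"
      and j: "j \<in> {1..m}" "w j \<noteq> \<zero>"
      using ex[of S] D by blast
    have jD: "j \<in> D" using j w S by blast
    have dM: "d \<in> msgs R m" and wM: "w \<in> msgs R m" using V less.prems w by auto
    \<comment> \<open>The factor \<open>r\<close> is chosen so that \<open>d + r w\<close> vanishes
      at \<open>j\<close>.\<close>
    define r where "r = \<ominus> (d j \<otimes> inv (w j))"
    have wj: "w j \<in> Units R" using j msgsD[OF wM] field_Units by auto
    have rC: "r \<in> carrier R" using j msgsD[OF dM] wj by (simp add: r_def)
    define d1 where "d1 = axpy R m d r w"
    define d2 where "d2 = axpy R m (\<lambda>i\<in>{1..m}. \<zero>) r w"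
    have d1V: "d1 \<in> V" and d2V: "d2 \<in> V" using V less.prems w rC by (auto simp: d1_def d2_def)
    have "d j \<oplus> r \<otimes> w j = \<zero>"
      using wj j msgsD[OF dM] msgsD[OF wM] by (simp add: r_def l_minus m_assoc r_neg)
    then have d1j: "d1 j = \<zero>" using j by (simp add: d1_def axpy_apply)
    have off: "w i = \<zero>" "d i = \<zero>" if "i \<in> {1..m}" "i \<notin> D" for i
      using that w S by (auto simp: D_def)
    have "{i\<in>{1..m}. d1 i \<noteq> \<zero>} \<subseteq> D - {j}"
    proof
      fix i assume i: "i \<in> {i\<in>{1..m}. d1 i \<noteq> \<zero>}"
      then have "i \<in> D" using off[of i] rC by (cases "i \<in> D") (auto simp: d1_def axpy_apply)
      then show "i \<in> D - {j}" using i d1j by auto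
    qed
    then have lt1: "card {i\<in>{1..m}. d1 i \<noteq> \<zero>} < card D"
      using jD D by (meson card_Diff1_less card_mono finite_Diff order_le_less_trans)
    have "{i\<in>{1..m}. d2 i \<noteq> \<zero>} \<subseteq> D - {s}"
    proof
      fix i assume i: "i \<in> {i\<in>{1..m}. d2 i \<noteq> \<zero>}"
      then have "i \<in> S" using w(2) rC by (cases "i \<in> S") (auto simp: d2_def axpy_apply)
      then show "i \<in> D - {s}" using S by blast
    qed
    then have lt2: "card {i\<in>{1..m}. d2 i \<noteq> \<zero>} < card D"
      using s D by (meson card_Diff1_less card_mono finite_Diff order_le_less_trans)
    have xd: "axpy R m x \<one> d \<in> msgs R m" using less.prems dM by (simp add: axpy_msgs)
    \<comment> \<open>From \<open>x + d\<close>, translating by \<open>d2 = r w\<close> leads to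
      \<open>x + d1\<close>, and translating \<open>x\<close> by \<open>d1\<close> leads there as
      well. The induction hypothesis covers both moves.\<close>
    have "K (axpy R m x \<one> d) = K (axpy R m (axpy R m x \<one> d) \<one> d2)"
      using less.hyps[OF _ d2V xd] lt2 by (simp add: D_def)
    also have "axpy R m (axpy R m x \<one> d) \<one> d2 = axpy R m x \<one> d1"
    proof (rule msgs_eqI)
      fix i assume i: "i \<in> {1..m}"
      then show "axpy R m (axpy R m x \<one> d) \<one> d2 i = axpy R m x \<one> d1 i"
        using msgsD[OF dM i] msgsD[OF wM i] msgsD[OF less.prems(2) i] rC
        by (simp add: axpy_apply d1_def d2_def a_assoc)
    qed (use xd less.prems d1V d2V V in \<open>auto intro!: axpy_msgs\<close>)
    also have "K \<dots> = K x" using less.hyps[OF _ d1V less.prems(2)] lt1 by (simp add: D_def)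
    finally show ?thesis .
  qed
qed

section \<open>The number of rounds of a linear protocol\<close>

lemma length_transcript [simp]: "length (transcript I sp f t x) = t"
  by (induction t) auto

text \<open>These vectors form a product set with singleton factors outside \<open>S\<close>. The
  count is later compared with the number of transcripts.\<close>

lemma card_msgs_supported:
  assumes "S \<subseteq> {1..m}" and zero: "\<zero>\<^bsub>R\<^esub> \<in> carrier R"
  shows "card {x \<in> msgs R m. \<forall>i\<in>{1..m} - S. x i = \<zero>\<^bsub>R\<^esub>} \<ge> card (carrier R) ^ card S"
proof -
  let ?A = "\<lambda>i. if i \<in> S then carrier R else {\<zero>\<^bsub>R\<^esub>}"
  have "{x \<in> msgs R m. \<forall>i\<in>{1..m} - S. x i = \<zero>\<^bsub>R\<^esub>} = PiE {1..m} ?A"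
  proof (intro equalityI subsetI)
    fix x assume "x \<in> PiE {1..m} ?A"
    then have x: "x i \<in> ?A i" if "i \<in> {1..m}" for i
      using that by (auto simp: PiE_iff)
    then have "x i \<in> carrier R" if "i \<in> {1..m}" for i
      using x[OF that] zero by (cases "i \<in> S") auto
    moreover have "x i = \<zero>\<^bsub>R\<^esub>" if "i \<in> {1..m} - S" for i
      using x[of i] that by auto
    ultimately show "x \<in> {x \<in> msgs R m. \<forall>i\<in>{1..m} - S. x i = \<zero>\<^bsub>R\<^esub>}"
      using \<open>x \<in> PiE {1..m} ?A\<close> by (auto simp: msgs_def PiE_iff)
  qed (auto simp: msgs_def PiE_iff)
  moreover have "card (PiE {1..m} ?A) = (\<Prod>i\<in>{1..m}. card (?A i))" by (rule card_PiE) simp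
  also have "\<dots> = (\<Prod>i\<in>S. card (carrier R))"
    using assms by (intro prod.mono_neutral_cong_right) auto
  ultimately show ?thesis by simp
qed

text \<open>With fewer rounds the key would be a function of the public transcript, which secrecy
  forbids because a uniform key takes more than one value.\<close>

lemma linear_protocol_lower_bound:
  assumes R: "field R" "finite (carrier R)"
    and I: "\<And>j. j \<in> {1..n} \<Longrightarrow> I j \<subseteq> {1..m}"
    and pair: "\<And>a b. a \<in> {1..m} \<Longrightarrow> b \<in> {1..m} \<Longrightarrow> a \<noteq> b \<Longrightarrow> \<exists>j\<in>{1..n}. I j \<subseteq> {a, b}"
    and prot: "is_protocol R n m I t sp f" and lin: "is_linear R m I t sp f"
    and SK: "generates_SK R n m I t sp f"
  shows "m \<le> t + 2"
proof (rule ccontr)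
  assume "\<not> m \<le> t + 2"
  then have m: "t + 3 \<le> m" by simp
  interpret field R by fact
  define T where "T = transcript I sp f t"
  have IM: "I (sp k) \<subseteq> {1..m}" if "k \<in> {1..t}" for k
    using prot I that by (auto simp: is_protocol_def)
  let ?lin = "\<lambda>k c. (\<forall>i\<in>I (sp k). c i \<in> carrier R) \<and>
    (\<forall>x\<in>msgs R m. T x ! (k - 1) = finsum R (\<lambda>i. c i \<otimes>\<^bsub>R\<^esub> x i) (I (sp k)))"
  have "\<forall>k\<in>{1..t}. \<exists>c. ?lin k c"
    using lin unfolding is_linear_def T_def .
  then obtain c' where "\<forall>k\<in>{1..t}. ?lin k (c' k)"
    by (rule bchoice[THEN exE])
  then obtain c where c: "\<And>k i. k \<in> {1..t} \<Longrightarrow> i \<in> I (sp k) \<Longrightarrow> c k i \<in> carrier R"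
      "\<And>k x. k \<in> {1..t} \<Longrightarrow> x \<in> msgs R m \<Longrightarrow>
        T x ! (k - 1) = finsum R (\<lambda>i. c k i \<otimes>\<^bsub>R\<^esub> x i) (I (sp k))"
    using that[of c'] by simp
  \<comment> \<open>The linear form sent in round \<open>k\<close>. Rounds are counted from 1 and
    list positions from 0, hence the index \<open>k - 1\<close> above.\<close>
  define \<phi> where "\<phi> k x = finsum R (\<lambda>i. c k i \<otimes>\<^bsub>R\<^esub> x i) (I (sp k))" for k x
  have \<phi>C: "\<phi> k x \<in> carrier R" if "k \<in> {1..t}" "x \<in> msgs R m" for k x
    unfolding \<phi>_def
  proof (rule finsum_closed, rule Pi_I)
    fix i assume "i \<in> I (sp k)"
    then show "c k i \<otimes>\<^bsub>R\<^esub> x i \<in> carrier R"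
      using c(1)[OF that(1)] IM[OF that(1)] msgsD[OF that(2)] by (intro m_closed) blast+
  qed
  have \<phi>_axpy: "\<phi> k (axpy R m x r y) = \<phi> k x \<oplus>\<^bsub>R\<^esub> r \<otimes>\<^bsub>R\<^esub> \<phi> k y"
    if "k \<in> {1..t}" "x \<in> msgs R m" "y \<in> msgs R m" "r \<in> carrier R" for k x y r
    unfolding \<phi>_def using finsum_axpy[of "I (sp k)" m "c k"] IM[OF that(1)] c(1)[OF that(1)] that(2-) by blast
  have T_eq: "T x = T y" if "x \<in> msgs R m" "y \<in> msgs R m" "\<And>k. k \<in> {1..t} \<Longrightarrow> \<phi> k x = \<phi> k y" for x y
  proof (rule nth_equalityI)
    fix i assume "i < length (T x)"
    then have "Suc i \<in> {1..t}" by (simp add: T_def)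
    then show "T x ! i = T y ! i" using c(2)[of "Suc i"] that by (simp add: \<phi>_def)
  qed (simp add: T_def)
  obtain kf where kf:
    "(\<forall>j\<in>{1..n}. \<forall>x\<in>msgs R m. kf j (restrict x (I j)) (T x) = kf 1 (restrict x (I 1)) (T x)) \<and>
     (\<forall>a\<in>carrier R. card {x\<in>msgs R m. kf 1 (restrict x (I 1)) (T x) = a} * card (carrier R)
        = card (msgs R m)) \<and>
     (\<forall>a \<tau>. card {x\<in>msgs R m. kf 1 (restrict x (I 1)) (T x) = a \<and> T x = \<tau>} * card (msgs R m)
        = card {x\<in>msgs R m. kf 1 (restrict x (I 1)) (T x) = a} * card {x\<in>msgs R m. T x = \<tau>})"
    using SK unfolding generates_SK_def Let_def T_def by (rule exE)
  have agree: "kf j (restrict x (I j)) (T x) = kf 1 (restrict x (I 1)) (T x)"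
    if "j \<in> {1..n}" "x \<in> msgs R m" for j x
    by (rule kf[THEN conjunct1, THEN bspec, THEN bspec, OF that])
  define K where "K x = kf 1 (restrict x (I 1)) (T x)" for x
  \<comment> \<open>The kernel of the transmitted map: realisations with equal transcripts differ by
    an element of \<open>V\<close>, and translating by such an element leaves the transcript
    unchanged.\<close>
  define V where "V = {d \<in> msgs R m. \<forall>k\<in>{1..t}. \<phi> k d = \<zero>\<^bsub>R\<^esub>}"
  define z where "z = (\<lambda>i\<in>{1..m}. \<zero>\<^bsub>R\<^esub>)"
  have z: "z \<in> msgs R m" by (auto simp: z_def msgs_def)
  have V_axpy: "axpy R m x r y \<in> V" if "x \<in> V" "y \<in> V" "r \<in> carrier R" for x y r
    using that by (auto simp: V_def \<phi>_axpy axpy_msgs)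
  have V_diff: "axpy R m x (\<ominus>\<^bsub>R\<^esub> \<one>\<^bsub>R\<^esub>) y \<in> V"
    if "x \<in> msgs R m" "y \<in> msgs R m" "\<And>k. k \<in> {1..t} \<Longrightarrow> \<phi> k x = \<phi> k y" for x y
    using that \<phi>C by (auto simp: V_def \<phi>_axpy axpy_msgs l_minus r_neg)
  have zV: "z \<in> V"
  proof -
    have "axpy R m z (\<ominus>\<^bsub>R\<^esub> \<one>\<^bsub>R\<^esub>) z = z" by (auto simp: axpy_def z_def)
    then show ?thesis using V_diff[OF z z] by simp
  qed
  have T_V: "T (axpy R m x \<one>\<^bsub>R\<^esub> d) = T x" if "x \<in> msgs R m" "d \<in> V" for x d
    using that \<phi>C by (intro T_eq) (auto simp: V_def \<phi>_axpy axpy_msgs)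
  \<comment> \<open>Pigeonhole: more vectors are supported on the \<open>t + 1\<close> coordinates
    of \<open>S\<close> than there are transcripts of length \<open>t\<close>. Two of them collide,
    and their difference is the required kernel vector.\<close>
  have ex: "\<exists>w\<in>V. (\<exists>i\<in>{1..m}. w i \<noteq> \<zero>\<^bsub>R\<^esub>) \<and> (\<forall>i\<in>{1..m} - S. w i = \<zero>\<^bsub>R\<^esub>)"
    if S: "S \<subseteq> {1..m}" "card S = Suc t" for S
  proof -
    define W where "W = {x \<in> msgs R m. \<forall>i\<in>{1..m} - S. x i = \<zero>\<^bsub>R\<^esub>}"
    have "card {\<zero>\<^bsub>R\<^esub>, \<one>\<^bsub>R\<^esub>} \<le> card (carrier R)" using R(2) by (intro card_mono) auto
    then have gt1: "1 < card (carrier R)" by simp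
    have "T ` W \<subseteq> {l. set l \<subseteq> carrier R \<and> length l = t}"
      using prot by (auto simp: is_protocol_def T_def W_def)
    then have "card (T ` W) \<le> card (carrier R) ^ t"
      using card_mono[OF finite_lists_length_eq[OF R(2)]] card_lists_length_eq[OF R(2)] by simp
    also have "\<dots> < card (carrier R) ^ card S" using gt1 S by simp
    also have "\<dots> \<le> card W" unfolding W_def using S by (intro card_msgs_supported) auto
    finally have "\<not> inj_on T W" using card_image[of T W] by linarith
    then obtain x y where xy: "x \<in> W" "y \<in> W" "T x = T y" "x \<noteq> y" by (auto simp: inj_on_def)
    have xM: "x \<in> msgs R m" and yM: "y \<in> msgs R m" using xy by (auto simp: W_def)
    let ?w = "axpy R m x (\<ominus>\<^bsub>R\<^esub> \<one>\<^bsub>R\<^esub>) y"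
    have "\<phi> k x = \<phi> k y" if "k \<in> {1..t}" for k
      using c(2)[OF that xM] c(2)[OF that yM] xy(3) by (simp add: \<phi>_def)
    then have "?w \<in> V" using V_diff xM yM by blast
    moreover obtain i where i: "i \<in> {1..m}" "x i \<noteq> y i" using xy(4) msgs_eqI[OF xM yM] by blast
    then have "?w i \<noteq> \<zero>\<^bsub>R\<^esub>"
      using msgsD[OF xM i(1)] msgsD[OF yM i(1)] minus_equality[of "x i" "\<ominus>\<^bsub>R\<^esub> y i"]
      by (auto simp: axpy_apply l_minus)
    moreover have "\<forall>i\<in>{1..m} - S. ?w i = \<zero>\<^bsub>R\<^esub>"
      using xy by (auto simp: W_def axpy_apply)
    ultimately show ?thesis using i(1) by blast
  qed
  \<comment> \<open>As \<open>m \<ge> t + 3\<close>, such a \<open>d\<close> vanishes at two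
    coordinates \<open>a\<close> and \<open>b\<close>. A client knowing nothing else sees the same
    messages and the same transcript after the translation, so it computes the same key.\<close>
  have small: "K (axpy R m x \<one>\<^bsub>R\<^esub> d) = K x"
    if x: "x \<in> msgs R m" and d: "d \<in> V" and sup: "card {i\<in>{1..m}. d i \<noteq> \<zero>\<^bsub>R\<^esub>} \<le> Suc t" for x d
  proof -
    have dM: "d \<in> msgs R m" using d by (simp add: V_def)
    have "{i\<in>{1..m}. d i = \<zero>\<^bsub>R\<^esub>} = {1..m} - {i\<in>{1..m}. d i \<noteq> \<zero>\<^bsub>R\<^esub>}" by auto
    then have "card {i\<in>{1..m}. d i = \<zero>\<^bsub>R\<^esub>} = card ({1..m} - {i\<in>{1..m}. d i \<noteq> \<zero>\<^bsub>R\<^esub>})"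
      by (rule arg_cong)
    also have "\<dots> = m - card {i\<in>{1..m}. d i \<noteq> \<zero>\<^bsub>R\<^esub>}"
      by (subst card_Diff_subset) auto
    finally have "card {i\<in>{1..m}. d i = \<zero>\<^bsub>R\<^esub>} = m - card {i\<in>{1..m}. d i \<noteq> \<zero>\<^bsub>R\<^esub>}" .
    then have "2 \<le> card {i\<in>{1..m}. d i = \<zero>\<^bsub>R\<^esub>}" using sup m by linarith
    then obtain A where "A \<subseteq> {i\<in>{1..m}. d i = \<zero>\<^bsub>R\<^esub>}" "card A = 2"
      using obtain_subset_with_card_n by metis
    then obtain a b where ab: "a \<in> {1..m}" "b \<in> {1..m}" "a \<noteq> b" "d a = \<zero>\<^bsub>R\<^esub>" "d b = \<zero>\<^bsub>R\<^esub>"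
      by (auto simp: card_2_iff)
    obtain j where j: "j \<in> {1..n}" "I j \<subseteq> {a, b}" using pair ab by blast
    have "restrict (axpy R m x \<one>\<^bsub>R\<^esub> d) (I j) = restrict x (I j)"
    proof (rule restrict_ext)
      fix i assume "i \<in> I j"
      then have "i \<in> {1..m}" "d i = \<zero>\<^bsub>R\<^esub>" using j ab by auto
      then show "axpy R m x \<one>\<^bsub>R\<^esub> d i = x i" using msgsD[OF x] by (simp add: axpy_apply)
    qed
    then have "kf j (restrict (axpy R m x \<one>\<^bsub>R\<^esub> d) (I j)) (T (axpy R m x \<one>\<^bsub>R\<^esub> d))
        = kf j (restrict x (I j)) (T x)"
      using T_V[OF x d] by simp
    then show ?thesis
      unfolding K_def using agree[OF j(1) x] agree[OF j(1) axpy_msgs[OF x dM one_closed]] by argo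
  qed
  have inv: "K (axpy R m x \<one>\<^bsub>R\<^esub> d) = K x" if "x \<in> msgs R m" "d \<in> V" for x d
    using invariant_if_invariant_small_support[of V m t K d x] V_axpy zV ex small that
    unfolding z_def V_def by blast
  \<comment> \<open>Invariance under the whole kernel makes \<open>K\<close> constant on the fibres
    of \<open>T\<close>.\<close>
  have K_T: "K x = K y" if xM: "x \<in> msgs R m" and yM: "y \<in> msgs R m" and "T x = T y" for x y
  proof -
    let ?d = "axpy R m y (\<ominus>\<^bsub>R\<^esub> \<one>\<^bsub>R\<^esub>) x"
    have "\<phi> k y = \<phi> k x" if "k \<in> {1..t}" for k
      using c(2)[OF that xM] c(2)[OF that yM] \<open>T x = T y\<close> by (simp add: \<phi>_def)
    then have d: "?d \<in> V" using V_diff xM yM by blast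
    have "axpy R m x \<one>\<^bsub>R\<^esub> ?d = y"
    proof (rule msgs_eqI)
      fix i assume i: "i \<in> {1..m}"
      then have "x i \<in> carrier R" "y i \<in> carrier R" using msgsD xM yM by blast+
      then show "axpy R m x \<one>\<^bsub>R\<^esub> ?d i = y i"
        using i a_lcomm[of "x i" "y i" "\<ominus>\<^bsub>R\<^esub> x i"] by (simp add: axpy_apply l_minus r_neg)
    qed (use xM yM in \<open>auto intro!: axpy_msgs\<close>)
    then show ?thesis using inv[OF xM d] by simp
  qed
  have finM: "finite (msgs R m)" unfolding msgs_def using R(2) by (intro finite_PiE) auto
  then have M0: "card (msgs R m) > 0" using z by (auto simp: card_gt_0_iff)
  \<comment> \<open>One of 0 and 1 differs from the key of the zero vector. By uniformity this value
    \<open>a\<close> occurs, and by independence it occurs together with the transcript of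
    \<open>z\<close>, against \<open>K_T\<close>.\<close>
  obtain a where a: "a \<in> carrier R" "a \<noteq> K z"
    using that[of "\<zero>\<^bsub>R\<^esub>"] that[of "\<one>\<^bsub>R\<^esub>"] by (cases "K z = \<zero>\<^bsub>R\<^esub>") auto
  have "card {x\<in>msgs R m. K x = a} * card (carrier R) = card (msgs R m)"
    unfolding K_def by (rule kf[THEN conjunct2, THEN conjunct1, THEN bspec, OF a(1)])
  then have "0 < card {x\<in>msgs R m. K x = a}"
    using M0 by (metis nat_0_less_mult_iff)
  moreover have "0 < card {x\<in>msgs R m. T x = T z}" using finM z by (auto simp: card_gt_0_iff)
  moreover have "card {x\<in>msgs R m. K x = a \<and> T x = T z} * card (msgs R m)
      = card {x\<in>msgs R m. K x = a} * card {x\<in>msgs R m. T x = T z}"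
    unfolding K_def by (rule kf[THEN conjunct2, THEN conjunct2, THEN spec, THEN spec])
  ultimately have "0 < card {x\<in>msgs R m. K x = a \<and> T x = T z} * card (msgs R m)"
    by (simp only: nat_0_less_mult_iff simp_thms)
  then have "0 < card {x\<in>msgs R m. K x = a \<and> T x = T z}"
    by (simp only: nat_0_less_mult_iff)
  then have "{x\<in>msgs R m. K x = a \<and> T x = T z} \<noteq> {}" by (simp only: card_gt_0_iff simp_thms)
  then obtain y where "y \<in> msgs R m" "K y = a" "T y = T z" by blast
  then show False using K_T[OF _ z] a by blast
qed

subsection \<open>A protocol on half symbols\<close>

text \<open>Exchanging \<open>a\<close> and \<open>b\<close> turns the inequality into equality, so
  the key is uniform given each transcript; summing over transcripts or over key values yields both
  claims. An injection between fibres is thus all that has to be supplied.\<close>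

lemma uniform_independent_if_translations:
  assumes fin: "finite M" "finite F" and K: "\<And>x. x \<in> M \<Longrightarrow> K x \<in> F"
    and le: "\<And>a b \<tau>. a \<in> F \<Longrightarrow> b \<in> F \<Longrightarrow>
      card {x\<in>M. K x = a \<and> T x = \<tau>} \<le> card {x\<in>M. K x = b \<and> T x = \<tau>}"
  shows "\<And>a. a \<in> F \<Longrightarrow> card {x\<in>M. K x = a} * card F = card M"
    and "\<And>a \<tau>. card {x\<in>M. K x = a \<and> T x = \<tau>} * card M
      = card {x\<in>M. K x = a} * card {x\<in>M. T x = \<tau>}"
proof -
  have eq: "card {x\<in>M. K x = a \<and> T x = \<tau>} = card {x\<in>M. K x = b \<and> T x = \<tau>}"
    if "a \<in> F" "b \<in> F" for a b \<tau>
    using le that by (intro antisym) auto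
  have by_K: "card A = (\<Sum>b\<in>F. card {x\<in>A. K x = b})" if "A \<subseteq> M" for A
  proof -
    have "K ` A \<subseteq> F" using that K by blast
    then show ?thesis using sum.group[of A F K "\<lambda>_. 1 :: nat"] fin finite_subset[OF that] by simp
  qed
  have by_T: "card A = (\<Sum>\<tau>\<in>T ` M. card {x\<in>A. T x = \<tau>})" if "A \<subseteq> M" for A
  proof -
    have "T ` A \<subseteq> T ` M" using that by blast
    then show ?thesis using sum.group[of A "T ` M" T "\<lambda>_. 1 :: nat"] fin finite_subset[OF that] by simp
  qed
  have K_eq: "card {x\<in>M. K x = a} = card {x\<in>M. K x = b}" if "a \<in> F" "b \<in> F" for a b
    using eq[OF that] by (subst (1 2) by_T) (auto intro!: sum.cong)
  show *: "card {x\<in>M. K x = a} * card F = card M" if "a \<in> F" for a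
  proof -
    have "card M = (\<Sum>b\<in>F. card {x\<in>M. K x = b})" by (rule by_K) simp
    also have "\<dots> = (\<Sum>b\<in>F. card {x\<in>M. K x = a})" by (intro sum.cong refl K_eq that)
    finally show ?thesis by simp
  qed
  show "card {x\<in>M. K x = a \<and> T x = \<tau>} * card M = card {x\<in>M. K x = a} * card {x\<in>M. T x = \<tau>}" for a \<tau>
  proof (cases "a \<in> F")
    case True
    have "card {x\<in>M. T x = \<tau>} = (\<Sum>b\<in>F. card {x\<in>{x\<in>M. T x = \<tau>}. K x = b})"
      by (rule by_K) auto
    also have "\<dots> = (\<Sum>b\<in>F. card {x\<in>M. K x = a \<and> T x = \<tau>})"
    proof (rule sum.cong)
      fix b assume "b \<in> F"
      have "{x\<in>{x\<in>M. T x = \<tau>}. K x = b} = {x\<in>M. K x = b \<and> T x = \<tau>}" by auto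
      then show "card {x\<in>{x\<in>M. T x = \<tau>}. K x = b} = card {x\<in>M. K x = a \<and> T x = \<tau>}"
        using eq[OF \<open>b \<in> F\<close> True] by simp
    qed simp
    finally show ?thesis using *[OF True] by (simp add: mult_ac)
  next
    \<comment> \<open>Secrecy is demanded for every \<open>a\<close> of the type; outside
      \<open>F\<close> both sides are zero.\<close>
    case False
    then have none: "K x \<noteq> a" if "x \<in> M" for x using K[OF that] by blast
    then have "{x\<in>M. K x = a \<and> T x = \<tau>} = {}" "{x\<in>M. K x = a} = {}" by auto
    then show ?thesis by (simp only: card.empty)
  qed
qed

text \<open>Here the key is a function of the full realisation. By \<open>det\<close> the view of
  each client determines it, which provides the key functions.\<close>

lemma generates_SKI:
  fixes R :: "('a, 'b) ring_scheme" and K :: "(nat \<Rightarrow> 'a) \<Rightarrow> 'a"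
  assumes fin: "finite (carrier R)" and n: "1 \<in> {1..n}"
    and K: "\<And>x. x \<in> msgs R m \<Longrightarrow> K x \<in> carrier R"
    and det: "\<And>j x y. j \<in> {1..n} \<Longrightarrow> x \<in> msgs R m \<Longrightarrow> y \<in> msgs R m \<Longrightarrow>
      restrict x (I j) = restrict y (I j) \<Longrightarrow> transcript I sp f t x = transcript I sp f t y \<Longrightarrow> K x = K y"
    and le: "\<And>a b \<tau>. a \<in> carrier R \<Longrightarrow> b \<in> carrier R \<Longrightarrow>
      card {x\<in>msgs R m. K x = a \<and> transcript I sp f t x = \<tau>}
        \<le> card {x\<in>msgs R m. K x = b \<and> transcript I sp f t x = \<tau>}"
  shows "generates_SK R n m I t sp f"
proof -
  define T where "T = transcript I sp f t"
  \<comment> \<open>A client evaluates \<open>K\<close> at any realisation compatible with its view;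
    by \<open>det\<close> the choice does not affect the value.\<close>
  define kf where "kf j u \<tau> = K (SOME x. x \<in> msgs R m \<and> restrict x (I j) = u \<and> T x = \<tau>)" for j u \<tau>
  have kf: "kf j (restrict x (I j)) (T x) = K x" if "j \<in> {1..n}" "x \<in> msgs R m" for j x
  proof -
    let ?P = "\<lambda>y. y \<in> msgs R m \<and> restrict y (I j) = restrict x (I j) \<and> T y = T x"
    have "?P (SOME y. ?P y)" using that(2) by (intro someI[of ?P x]) simp
    then show ?thesis unfolding kf_def using det[OF that(1) _ that(2)] unfolding T_def by blast
  qed
  have finM: "finite (msgs R m)" unfolding msgs_def using fin by (intro finite_PiE) auto
  have sets: "{x\<in>msgs R m. kf 1 (restrict x (I 1)) (T x) = a} = {x\<in>msgs R m. K x = a}"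
    "{x\<in>msgs R m. kf 1 (restrict x (I 1)) (T x) = a \<and> T x = \<tau>} = {x\<in>msgs R m. K x = a \<and> T x = \<tau>}"
    for a \<tau>
    using kf[OF n] by auto
  show ?thesis
    unfolding generates_SK_def Let_def T_def[symmetric]
  proof (intro exI[of _ kf] conjI ballI allI)
    fix j x assume "j \<in> {1..n}" "x \<in> msgs R m"
    then show "kf j (restrict x (I j)) (T x) = kf 1 (restrict x (I 1)) (T x)"
      using kf n by simp
  next
    fix a assume "a \<in> carrier R"
    then show "card {x\<in>msgs R m. kf 1 (restrict x (I 1)) (T x) = a} * card (carrier R) = card (msgs R m)"
      unfolding sets using uniform_independent_if_translations(1)[OF finM fin K le] by blast
  next
    fix a \<tau>
    show "card {x\<in>msgs R m. kf 1 (restrict x (I 1)) (T x) = a \<and> T x = \<tau>} * card (msgs R m)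
      = card {x\<in>msgs R m. kf 1 (restrict x (I 1)) (T x) = a} * card {x\<in>msgs R m. T x = \<tau>}"
      unfolding sets unfolding T_def
      using uniform_independent_if_translations(2)[OF finM fin K le] by blast
  qed
qed

section \<open>Non-adaptive transcripts and syndromes\<close>

lemma transcript_nonadaptive:
  "transcript I sp (\<lambda>k x _. g k x) t x = map (\<lambda>k. g k (restrict x (I (sp k)))) [1..<Suc t]"
  by (induction t) (simp_all del: restrict_apply)

text \<open>The code consists of the words with \<open>i\<close>-th entry \<open>u + (i - 1) v\<close>; entries 1 and 2 are used for
  interpolation, so their syndromes vanish.\<close>

definition syndrome :: "int \<Rightarrow> (nat \<Rightarrow> int) \<Rightarrow> nat \<Rightarrow> int" where
  "syndrome p a i = (a i - a 1 - (int i - 1) * (a 2 - a 1)) mod p"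

lemma syndrome_1 [simp]: "syndrome p a 1 = 0" "syndrome p a (Suc 0) = 0"
  and syndrome_2 [simp]: "syndrome p a 2 = 0"
  by (simp_all add: syndrome_def)

text \<open>Adding a code word does not change syndromes. Only the entries 1, 2 and \<open>j\<close>
  enter the formula.\<close>

lemma syndrome_translate:
  assumes "\<And>i. i \<in> {1, 2, j} \<Longrightarrow> [b i = a i + u + (int i - 1) * v] (mod p)"
  shows "syndrome p b j = syndrome p a j"
proof -
  have "[b j - b 1 - (int j - 1) * (b 2 - b 1) =
      (a j + u + (int j - 1) * v) - (a 1 + u + (int 1 - 1) * v)
        - (int j - 1) * ((a 2 + u + (int 2 - 1) * v) - (a 1 + u + (int 1 - 1) * v))] (mod p)"
    by (intro cong_diff cong_mult cong_refl assms) simp_all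
  also have "(a j + u + (int j - 1) * v) - (a 1 + u + (int 1 - 1) * v)
        - (int j - 1) * ((a 2 + u + (int 2 - 1) * v) - (a 1 + u + (int 1 - 1) * v))
      = a j - a 1 - (int j - 1) * (a 2 - a 1)"
    by (simp add: algebra_simps)
  finally show ?thesis by (simp add: syndrome_def cong_def)
qed

text \<open>The difference of the two words has zero syndromes, so modulo \<open>p\<close> it is an
  affine function of the index. It vanishes at \<open>i\<close> and \<open>j\<close>, which are
  distinct modulo \<open>p\<close> because \<open>m \<le> p\<close>; hence its slope and its first
  entry vanish.\<close>

lemma eq_if_syndromes_eq:
  assumes p: "prime (int p)" "m \<le> p"
    and ij: "i \<in> {1..m}" "j \<in> {1..m}" "i \<noteq> j" "a i = b i" "a j = b j"
    and syn: "\<And>i. i \<in> {1..m} \<Longrightarrow> syndrome p a i = syndrome p b i"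
  shows "[a 1 = b 1] (mod p)" "[a 2 = b 2] (mod p)"
proof -
  define d where "d i = a i - b i" for i
  have d: "int p dvd d k - d 1 - (int k - 1) * (d 2 - d 1)" if "k \<in> {1..m}" for k
    using syn[OF that] unfolding syndrome_def cong_def[symmetric] cong_iff_dvd_diff
    by (simp add: d_def algebra_simps)
  have "int p dvd (d j - d 1 - (int j - 1) * (d 2 - d 1)) - (d i - d 1 - (int i - 1) * (d 2 - d 1))"
    by (rule dvd_diff[OF d[OF ij(2)] d[OF ij(1)]])
  also have "\<dots> = (int i - int j) * (d 2 - d 1)"
    using ij by (simp add: d_def algebra_simps)
  finally have "int p dvd int i - int j \<or> int p dvd d 2 - d 1"
    using p(1) prime_dvd_mult_iff by blast
  moreover have "\<not> int p dvd int i - int j"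
  proof
    assume "int p dvd int i - int j"
    then have "\<bar>int p\<bar> \<le> \<bar>int i - int j\<bar>" using ij by (intro dvd_imp_le_int) auto
    then show False using ij p by auto
  qed
  ultimately have D: "int p dvd d 2 - d 1" by blast
  have "int p dvd - (d i - d 1 - (int i - 1) * (d 2 - d 1))"
    using d[OF ij(1)] by (simp only: dvd_minus_iff)
  then have "int p dvd - (d i - d 1 - (int i - 1) * (d 2 - d 1)) - (int i - 1) * (d 2 - d 1)"
    by (rule dvd_diff[OF _ dvd_mult[OF D]])
  then have d1: "int p dvd d 1" using ij by (simp add: d_def)
  then have "int p dvd (d 2 - d 1) + d 1" using D by (intro dvd_add)
  then have "int p dvd d 2" by simp
  with d1 show "[a 1 = b 1] (mod p)" "[a 2 = b 2] (mod p)"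
    by (auto simp: cong_iff_dvd_diff d_def)
qed

section \<open>Agreement and secrecy with \<open>h - 1\<close> rounds\<close>

lemma half_symbol_protocol:
  fixes R :: "('a, 'b) ring_scheme"
  assumes card: "finite (carrier R)" "card (carrier R) = p * p"
    and p: "prime p" "2 * h \<le> p" and h: "h \<ge> 1" and n: "1 \<in> {1..n}" "I 1 = {1..2*h}"
    and pair: "\<And>j. j \<in> {1..n} \<Longrightarrow> \<exists>a b. {a, b} \<subseteq> I j \<inter> {1..2*h} \<and> a \<noteq> b"
  shows "\<exists>sp f. is_protocol R n (2*h) I (h - 1) sp f \<and> generates_SK R n (2*h) I (h - 1) sp f"
proof -
  let ?Z = "{0..<int p}" and ?M = "msgs R (2*h)"
  have "card (?Z \<times> ?Z) = card (carrier R)" using card by (simp add: card_cartesian_product)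
  \<comment> \<open>Any bijection will do for splitting a symbol into two residues modulo
    \<open>p\<close>.\<close>
  then obtain enc :: "int \<times> int \<Rightarrow> 'a" where enc: "bij_betw enc (?Z \<times> ?Z) (carrier R)"
    using finite_same_card_bij[of "?Z \<times> ?Z" "carrier R"] card(1) by auto
  define dec where "dec = the_inv_into (?Z \<times> ?Z) enc"
  have p0: "int p > 0" using p(1) by (simp add: prime_gt_0_nat)
  have encC: "enc (u, v) \<in> carrier R" if "u \<in> ?Z" "v \<in> ?Z" for u v
    using enc that by (auto simp: bij_betw_def)
  have dec_enc: "dec (enc (u, v)) = (u, v)" if "u \<in> ?Z" "v \<in> ?Z" for u v
    using enc that unfolding dec_def by (auto simp: bij_betw_def the_inv_into_f_f)
  have enc_dec: "enc (dec a) = a" if "a \<in> carrier R" for a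
    using enc that unfolding dec_def by (simp add: bij_betw_def f_the_inv_into_f)
  have decZ: "dec a \<in> ?Z \<times> ?Z" if "a \<in> carrier R" for a
    using enc that unfolding dec_def by (auto simp: bij_betw_def intro!: the_inv_into_into)
  have MC: "x i \<in> carrier R" if "x \<in> ?M" "i \<in> {1..2*h}" for x i
    using that by (auto simp: msgs_def)
  define \<alpha> where "\<alpha> x i = fst (dec (x i))" for x and i :: nat
  have \<alpha>Z: "\<alpha> x i \<in> ?Z" if "x \<in> ?M" "i \<in> {1..2*h}" for x i
    using decZ[OF MC[OF that]] by (auto simp: \<alpha>_def mem_Times_iff)
  define K where "K x = enc (\<alpha> x 1, \<alpha> x 2)" for x
  define s where "s x i = syndrome p (\<alpha> x) i" for x i
  have sZ: "s x i \<in> ?Z" for x i using p0 by (simp add: s_def syndrome_def)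
  \<comment> \<open>Round \<open>k\<close> packs two syndromes into one symbol. Rounds 1 to
    \<open>h - 1\<close> cover the entries 3 to \<open>2*h\<close>; the syndromes of entries 1 and 2
    are always zero.\<close>
  define g where "g k x = enc (s x (2*k+1), s x (2*k+2))" for k x
  define sp where "sp = (\<lambda>k::nat. 1::nat)"
  define f where "f = (\<lambda>k x (_ :: 'a list). g k x)"
  define T where "T = transcript I sp f (h - 1)"
  have T: "T x = map (\<lambda>k. g k x) [1..<h]" if "x \<in> ?M" for x
  proof -
    have "restrict x (I (sp k)) = x" for k using that n by (auto simp: sp_def msgs_def)
    then show ?thesis using h unfolding T_def f_def by (simp add: transcript_nonadaptive)
  qed
  have one_two: "1 \<in> {1..2*h}" "2 \<in> {1..2*h}" using h by auto
  have KC: "K x \<in> carrier R" if "x \<in> ?M" for x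
    unfolding K_def using \<alpha>Z[OF that] one_two by (intro encC)
  have T_eqI: "T x = T y" if "x \<in> ?M" "y \<in> ?M" "\<And>i. i \<in> {1..2*h} \<Longrightarrow> s x i = s y i" for x y
    using that by (auto simp: T g_def)
  have T_eqD: "s x i = s y i" if xy: "x \<in> ?M" "y \<in> ?M" "T x = T y" and i: "i \<in> {1..2*h}" for x y i
  proof (cases "i \<le> 2")
    case True
    then have "i = 1 \<or> i = 2" using i by auto
    then show ?thesis by (auto simp: s_def)
  next
    case False
    \<comment> \<open>The round that carries entry \<open>i\<close>.\<close>
    define k where "k = (i - 1) div 2"
    have k: "k \<in> {1..<h}" "i = 2*k+1 \<or> i = 2*k+2" using False i unfolding k_def by auto
    have "g k x = g k y" using xy k(1) by (simp add: T)
    then have "(s x (2*k+1), s x (2*k+2)) = (s y (2*k+1), s y (2*k+2))"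
      unfolding g_def using dec_enc sZ by metis
    then show ?thesis using k(2) by auto
  qed
  have "is_protocol R n (2*h) I (h - 1) sp f"
    unfolding is_protocol_def T_def[symmetric] using n encC sZ by (auto simp: sp_def T g_def)
  moreover have "generates_SK R n (2*h) I (h - 1) sp f"
  proof (rule generates_SKI[OF card(1) n(1) KC])
    fix j x y
    assume j: "j \<in> {1..n}" and xy: "x \<in> ?M" "y \<in> ?M" "restrict x (I j) = restrict y (I j)"
      "transcript I sp f (h - 1) x = transcript I sp f (h - 1) y"
    obtain a b where ab: "a \<in> I j" "b \<in> I j" "a \<in> {1..2*h}" "b \<in> {1..2*h}" "a \<noteq> b"
      using pair[OF j] by auto
    have "x a = y a" "x b = y b" using ab xy(3) by (metis restrict_apply')+
    then have "\<alpha> x a = \<alpha> y a" "\<alpha> x b = \<alpha> y b" by (simp_all add: \<alpha>_def)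
    \<comment> \<open>Two common first halves together with the syndromes fix the first halves of
      messages 1 and 2 modulo \<open>p\<close>. As these lie in \<open>{0..<p}\<close>, the
      congruences become equalities.\<close>
    then have "[\<alpha> x 1 = \<alpha> y 1] (mod p)" "[\<alpha> x 2 = \<alpha> y 2] (mod p)"
      using eq_if_syndromes_eq[of p "2*h" a b "\<alpha> x" "\<alpha> y"] T_eqD[OF xy(1,2)] xy(4) ab p
      unfolding s_def T_def by auto
    then have "\<alpha> x 1 = \<alpha> y 1" "\<alpha> x 2 = \<alpha> y 2"
      using \<alpha>Z one_two xy(1,2) by (auto intro!: cong_less_imp_eq_int)
    then show "K x = K y" by (simp add: K_def)
  next
    fix a b \<tau> assume a: "a \<in> carrier R" and b: "b \<in> carrier R"
    \<comment> \<open>The code word with entries \<open>u + (i - 1) v\<close> is the one whose first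
      two entries, \<open>u\<close> and \<open>u + v\<close>, carry key \<open>a\<close> to key
      \<open>b\<close>. Adding it to the first halves and keeping the second halves is injective and
      preserves all syndromes, so it embeds one fibre into the other.\<close>
    define u where "u = fst (dec b) - fst (dec a)"
    define v where "v = snd (dec b) - snd (dec a) - u"
    define shift where "shift x = (\<lambda>i\<in>{1..2*h}. enc ((\<alpha> x i + u + (int i - 1) * v) mod p, snd (dec (x i))))"
      for x
    have sndZ: "snd (dec (x i)) \<in> ?Z" if "x \<in> ?M" "i \<in> {1..2*h}" for x i
      using decZ[OF MC[OF that]] by (auto simp: mem_Times_iff)
    have modZ: "z mod int p \<in> ?Z" for z using p0 by simp
    have dec_shift: "dec (shift x i) = ((\<alpha> x i + u + (int i - 1) * v) mod p, snd (dec (x i)))"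
      if "x \<in> ?M" "i \<in> {1..2*h}" for x i
      using that dec_enc[OF modZ sndZ[OF that]] by (simp add: shift_def)
    have \<alpha>_shift: "\<alpha> (shift x) i = (\<alpha> x i + u + (int i - 1) * v) mod p"
      if "x \<in> ?M" "i \<in> {1..2*h}" for x i
      using dec_shift[OF that] by (simp add: \<alpha>_def)
    have shiftM: "shift x \<in> ?M" if "x \<in> ?M" for x
      unfolding msgs_def shift_def using encC[OF modZ sndZ[OF that]] by auto
    have "inj_on shift ?M"
    proof (rule inj_onI)
      fix x y assume x: "x \<in> ?M" and y: "y \<in> ?M" and eq: "shift x = shift y"
      have "x i = y i" if i: "i \<in> {1..2*h}" for i
      proof -
        have *: "((\<alpha> x i + u + (int i - 1) * v) mod p, snd (dec (x i)))
            = ((\<alpha> y i + u + (int i - 1) * v) mod p, snd (dec (y i)))"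
          using dec_shift[OF x i] dec_shift[OF y i] eq by simp
        then have "[\<alpha> x i + (u + (int i - 1) * v) = \<alpha> y i + (u + (int i - 1) * v)] (mod p)"
          by (simp add: cong_def add.assoc)
        then have "[\<alpha> x i = \<alpha> y i] (mod p)" using cong_add_rcancel by blast
        then have "\<alpha> x i = \<alpha> y i"
          using \<alpha>Z[OF x i] \<alpha>Z[OF y i] by (auto intro!: cong_less_imp_eq_int)
        then have "dec (x i) = dec (y i)" using * by (simp add: \<alpha>_def prod_eq_iff)
        then show ?thesis using enc_dec MC x y i by metis
      qed
      then show "x = y" using x y unfolding msgs_def by (intro PiE_ext)
    qed
    moreover have "shift ` {x\<in>?M. K x = a \<and> T x = \<tau>} \<subseteq> {x\<in>?M. K x = b \<and> T x = \<tau>}"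
    proof
      fix y assume "y \<in> shift ` {x\<in>?M. K x = a \<and> T x = \<tau>}"
      then obtain x where y: "y = shift x" and x: "x \<in> ?M" "K x = a" "T x = \<tau>" by blast
      have deca: "dec a = (\<alpha> x 1, \<alpha> x 2)"
        using x(2) dec_enc \<alpha>Z[OF x(1)] one_two unfolding K_def by metis
      have decb: "fst (dec b) \<in> ?Z" "snd (dec b) \<in> ?Z"
        using decZ[OF b] by (auto simp: mem_Times_iff)
      have "\<alpha> y 1 = fst (dec b)" "\<alpha> y 2 = snd (dec b)"
        using \<alpha>_shift[OF x(1)] one_two decb by (simp_all add: y deca u_def v_def)
      then have "K y = b" using enc_dec[OF b] by (simp add: K_def)
      moreover have "T y = T x"
      proof (rule T_eqI)
        fix i assume "i \<in> {1..2*h}"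
        then show "s y i = s x i"
          unfolding s_def y using \<alpha>_shift[OF x(1)] one_two
          by (intro syndrome_translate[where u = u and v = v]) auto
      qed (use x shiftM y in auto)
      ultimately show "y \<in> {x\<in>?M. K x = b \<and> T x = \<tau>}" using x shiftM y by simp
    qed
    moreover have "finite ?M" unfolding msgs_def using card(1) by (intro finite_PiE) auto
    ultimately show "card {x\<in>?M. K x = a \<and> transcript I sp f (h - 1) x = \<tau>}
        \<le> card {x\<in>?M. K x = b \<and> transcript I sp f (h - 1) x = \<tau>}"
      unfolding T_def by (intro card_inj_on_le) (auto intro: inj_on_subset)
  qed
  ultimately show ?thesis by blast
qed

subsection \<open>The separation\<close>

text \<open>Client \<open>j = a * m + b + 1\<close> encodes the ordered pair \<open>(a, b)\<close>
  with entries below \<open>m\<close>, so each pair of messages appears twice. The diagonal, which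
  includes client 1, is given all messages.\<close>

definition pair_clients :: "nat \<Rightarrow> nat \<Rightarrow> nat set" where
  "pair_clients m j = (let a = (j - 1) div m; b = (j - 1) mod m in
     if a = b then {1..m} else {a + 1, b + 1})"

lemma pair_clients_1: "pair_clients m 1 = {1..m}"
  by (simp add: pair_clients_def)

lemma pair_clients_subset:
  assumes "j \<in> {1..m * m}"
  shows "pair_clients m j \<subseteq> {1..m}"
proof -
  have "m > 0" using assms by (cases m) auto
  moreover have "(j - 1) div m < m"
    using assms by (intro less_mult_imp_div_less) auto
  ultimately show ?thesis by (auto simp: pair_clients_def Let_def Suc_le_eq)
qed

lemma pair_clients_surj:
  assumes "a \<in> {1..m}" "b \<in> {1..m}" "a \<noteq> b"
  shows "\<exists>j\<in>{1..m * m}. pair_clients m j = {a, b}"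
proof -
  obtain a' b' where ab: "a = Suc a'" "b = Suc b'" "a' < m" "b' < m"
    using assms by (cases a; cases b) auto
  let ?j = "a' * m + b' + 1"
  have "?j \<le> Suc a' * m" using ab by simp
  also have "\<dots> \<le> m * m" using ab by (intro mult_le_mono1) simp
  finally have "?j \<in> {1..m * m}" by simp
  moreover have "pair_clients m ?j = {a, b}"
    using ab assms(3) by (simp add: pair_clients_def)
  ultimately show ?thesis by blast
qed

lemma pair_clients_two:
  assumes "2 \<le> m" "j \<in> {1..m * m}"
  shows "\<exists>a b. {a, b} \<subseteq> pair_clients m j \<inter> {1..m} \<and> a \<noteq> b"
proof (cases "(j - 1) div m = (j - 1) mod m")
  case True
  then have "{1, 2} \<subseteq> pair_clients m j \<inter> {1..m}" using assms by (auto simp: pair_clients_def)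
  then show ?thesis by (metis one_eq_numeral_iff semiring_norm(85))
next
  case False
  let ?a = "(j - 1) div m + 1" and ?b = "(j - 1) mod m + 1"
  have eq: "pair_clients m j = {?a, ?b}" using False by (simp add: pair_clients_def)
  then have "{?a, ?b} \<subseteq> pair_clients m j \<inter> {1..m}"
    using pair_clients_subset[OF assms(2)] by blast
  moreover have "?a \<noteq> ?b" using False by simp
  ultimately show ?thesis by blast
qed

theorem theorem4:
  fixes k :: int
  shows "\<exists>(R :: nat ring) (n :: nat) (m :: nat) (I :: nat \<Rightarrow> nat set).
           field R \<and> finite (carrier R) \<and> n < card (carrier R) \<and> 0 < m \<and>
           (\<forall>j\<in>{1..n}. I j \<subseteq> {1..m}) \<and> (\<Union>j\<in>{1..n}. I j) = {1..m} \<and>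
           ereal_of_enat (SK_min_lin R n m I)
             > ereal_of_enat (SK_min R n m I) + ereal (real_of_int k)"
proof -
  \<comment> \<open>The gap between the two bounds is
    \<open>(m - 2) - (h - 1) = h - 1 = nat k + 1\<close>, which exceeds \<open>k\<close>, also for
    negative \<open>k\<close>.\<close>
  define h where "h = nat k + 2"
  define m where "m = 2 * h"
  let ?I = "pair_clients m" and ?n = "m * m"
  \<comment> \<open>The condition \<open>m < p\<close> makes the indices distinct modulo
    \<open>p\<close>, excludes \<open>p = 2\<close>, and gives \<open>m * m < p * p\<close>, so the
    field has more elements than there are clients.\<close>
  obtain p where p: "prime p" "m < p" using bigger_prime by blast
  have "2 < p" using p(2) by (simp add: m_def h_def)
  then obtain R :: "nat ring" where R: "field R" "finite (carrier R)" "card (carrier R) = p * p"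
    using exists_field_prime_square[OF p(1)] by blast
  have m0: "0 < m" "2 \<le> m" by (auto simp: m_def h_def)
  have n1: "1 \<in> {1..?n}" using m0 by simp
  have "?n < card (carrier R)" unfolding R(3) using p(2) by (intro mult_strict_mono) auto
  moreover have "\<forall>j\<in>{1..?n}. ?I j \<subseteq> {1..m}" using pair_clients_subset by blast
  moreover have "(\<Union>j\<in>{1..?n}. ?I j) = {1..m}"
    using pair_clients_subset pair_clients_1 n1 by blast
  moreover have "ereal_of_enat (SK_min R ?n m ?I) + ereal (real_of_int k)
      < ereal_of_enat (SK_min_lin R ?n m ?I)"
  proof -
    have "\<exists>sp f. is_protocol R ?n m ?I (h - 1) sp f \<and> generates_SK R ?n m ?I (h - 1) sp f"
      using half_symbol_protocol[OF R(2,3) p(1) _ _ n1, of h ?I] p(2) pair_clients_1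
        pair_clients_two[OF m0(2)]
      unfolding m_def[symmetric] by (simp add: h_def)
    then have "SK_min R ?n m ?I \<le> enat (h - 1)"
      unfolding SK_min_def by (intro Inf_lower) blast
    then have "ereal_of_enat (SK_min R ?n m ?I) \<le> ereal_of_enat (enat (h - 1))"
      by (simp only: ereal_of_enat_le_iff)
    then have "ereal_of_enat (SK_min R ?n m ?I) + ereal (real_of_int k)
        \<le> ereal (real (h - 1)) + ereal (real_of_int k)"
      by (intro add_right_mono) simp
    also have "\<dots> < ereal (real (m - 2))" by (simp add: m_def h_def)
    also have "\<dots> = ereal_of_enat (enat (m - 2))" by simp
    also have "enat (m - 2) \<le> SK_min_lin R ?n m ?I"
      unfolding SK_min_lin_def
    \<comment> \<open>Bounding every element of the set also covers the empty set, whose infimum is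
      infinite.\<close>
    proof (rule Inf_greatest)
      fix e assume "e \<in> enat ` {t. \<exists>sp f. is_protocol R ?n m ?I t sp f \<and> is_linear R m ?I t sp f
        \<and> generates_SK R ?n m ?I t sp f}"
      then obtain t sp f where e: "e = enat t" and prot: "is_protocol R ?n m ?I t sp f"
        "is_linear R m ?I t sp f" "generates_SK R ?n m ?I t sp f"
        by blast
      have "m \<le> t + 2"
      proof (rule linear_protocol_lower_bound[OF R(1,2) _ _ prot])
        show "\<exists>j\<in>{1..?n}. ?I j \<subseteq> {a, b}" if "a \<in> {1..m}" "b \<in> {1..m}" "a \<noteq> b" for a b
          using pair_clients_surj[OF that] by blast
      qed (rule pair_clients_subset)
      then show "enat (m - 2) \<le> e" by (simp add: e)
    qed
    then have "ereal_of_enat (enat (m - 2)) \<le> ereal_of_enat (SK_min_lin R ?n m ?I)"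
      by (simp only: ereal_of_enat_le_iff)
    finally show ?thesis .
  qed
  ultimately show ?thesis using R(1,2) m0(1) by blast
qed

end
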